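(* Let $G_4=(V,E)$ be a finite digraph whose vertex set is partitioned as $V=V_1\cup W_1$ with $V_1\cap W_1=\varnothing$, $V_1=\{v_1,\dots,v_n\}$, $W_1=\{w_1,\dots,w_m\}$, such that for every $v\in V_1$ and every $w\in W_1$ there is exactly one directed edge $(v,w)\in E$, and $d_{\mathrm{out}}(w)=0$ for every $w\in W_1$ (edges among vertices of $V_1$ are arbitrary). Write a position of Digraph Yama Nim on $G_4$ as $(x_1,\dots,x_n,y_1,\dots,y_m)$, where $x_i$ is the number of tokens on $v_i$ and $y_j$ the number on $w_j$. If $m=|W_1|$ is odd, then the Sprague–Grundy value of this position is $$g(x_1,\dots,x_n,y_1,\dots,y_m)=y_1\oplus y_2\oplus\cdots\oplus y_m.$$ In particular, the position is a $\mathcal{P}$-position if and only if $y_1\oplus\cdots\oplus y_m=0$.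
   Context: Digraph Yama Nim on a finite digraph $G=(V,E)$: a position assigns a non-negative integer number of tokens to each vertex. On a turn, a player chooses a vertex $v$ and removes at least $d_{\mathrm{out}}(v)+1$ tokens from $v$ (where $d_{\mathrm{out}}(v)$ is the out-degree of $v$), and simultaneously adds one token to each out-neighbour of $v$; other counts are unchanged. Normal play: the player making the last move wins. A $\mathcal{P}$-position is one where the previous player (not the player to move) has a winning strategy. The Sprague–Grundy value is defined recursively by $g(p)=\mathrm{mex}\{g(p')\mid p' \text{ an option of } p\}$, where $\mathrm{mex}(X)$ is the least non-negative integer not in $X$. $\oplus$ denotes bitwise XOR (nim-sum) of non-negative integers in binary. *)

theory Defs
  imports "Graph_Theory.Pair_Digraph"
begin

section \<open>Impartial games under normal play\<close>

text \<open>
  A game is given by a function mapping each position to the set of its options. The play ends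
  at a position without options, and the player who has to move there loses.
\<close>

definition mex :: "nat set \<Rightarrow> nat" where
  "mex X = (LEAST n. n \<notin> X)"

definition options_rel :: "('p \<Rightarrow> 'p set) \<Rightarrow> ('p \<times> 'p) set" where
  "options_rel opts = {(q, p). q \<in> opts p}"

text \<open>
  The recursion is well-founded exactly for terminating games, where the defining equation
  is \<open>grundy_rec\<close> below.
\<close>

definition grundy :: "('p \<Rightarrow> 'p set) \<Rightarrow> 'p \<Rightarrow> nat" where
  "grundy opts = wfrec (options_rel opts) (\<lambda>g p. mex (g ` opts p))"

lemma grundy_rec:
  assumes "wf (options_rel opts)"
  shows "grundy opts p = mex (grundy opts ` opts p)"
proof -
  have "cut (grundy opts) (options_rel opts) p ` opts p = grundy opts ` opts p"
    by (intro image_cong refl) (auto simp: cut_def options_rel_def)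
  then show ?thesis
    by (subst grundy_def, subst wfrec[OF assms]) (simp add: grundy_def)
qed

text \<open>
  A play from \<open>p\<close>, possibly unfinished, is the nonempty list of the positions visited so far,
  beginning with \<open>p\<close>. The next player (the one to move at \<open>p\<close>) is on turn when the list has odd
  length, the previous player when it has even length.
\<close>

definition is_play :: "('p \<Rightarrow> 'p set) \<Rightarrow> 'p \<Rightarrow> 'p list \<Rightarrow> bool" where
  "is_play opts p ps \<longleftrightarrow> ps \<noteq> [] \<and> hd ps = p \<and> successively (\<lambda>a b. b \<in> opts a) ps"

text \<open>
  A strategy of the previous player maps the history of the play to the position moved to.
  It has to prescribe a legal move whenever that player is on turn and a move exists.
\<close>

definition prev_strategy :: "('p \<Rightarrow> 'p set) \<Rightarrow> 'p \<Rightarrow> ('p list \<Rightarrow> 'p) \<Rightarrow> bool" where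
  "prev_strategy opts p \<sigma> \<longleftrightarrow>
     (\<forall>ps. is_play opts p ps \<and> even (length ps) \<and> opts (last ps) \<noteq> {} \<longrightarrow> \<sigma> ps \<in> opts (last ps))"

definition prev_follows :: "('p list \<Rightarrow> 'p) \<Rightarrow> 'p list \<Rightarrow> bool" where
  "prev_follows \<sigma> ps \<longleftrightarrow>
     (\<forall>i. 0 < i \<and> i < length ps \<and> even i \<longrightarrow> ps ! i = \<sigma> (take i ps))"

text \<open>
  For terminating games. A finished play of odd length leaves the next player on turn
  without a move, so it is won by the previous player.
\<close>

definition P_position :: "('p \<Rightarrow> 'p set) \<Rightarrow> 'p \<Rightarrow> bool" where
  "P_position opts p \<longleftrightarrow>
     (\<exists>\<sigma>. prev_strategy opts p \<sigma> \<and>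
          (\<forall>ps. is_play opts p ps \<and> prev_follows \<sigma> ps \<and> opts (last ps) = {} \<longrightarrow> odd (length ps)))"


section \<open>Nim-sum over a finite set\<close>

unbundle bit_operations_syntax

definition nim_sum :: "('a \<Rightarrow> nat) \<Rightarrow> 'a set \<Rightarrow> nat" where
  "nim_sum = comm_monoid_set.F (XOR) 0"

interpretation nim_sum: comm_monoid_set "(XOR) :: nat \<Rightarrow> nat \<Rightarrow> nat" 0
  rewrites "comm_monoid_set.F (XOR) 0 = nim_sum"
proof -
  show "comm_monoid_set ((XOR) :: nat \<Rightarrow> nat \<Rightarrow> nat) 0"
    by unfold_locales
  show "comm_monoid_set.F (XOR) 0 = nim_sum"
    by (simp add: nim_sum_def)
qed


section \<open>Digraph Yama Nim\<close>

text \<open>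
  A position on \<open>G\<close> is a function assigning to each vertex its number of tokens; values outside
  \<open>pverts G\<close> play no role and never change. In a move at \<open>v\<close>, \<open>k\<close> is the number of tokens removed.
  If \<open>G\<close> has a loop at \<open>v\<close>, then \<open>v\<close> is one of its own out-neighbours and gets one token back.
\<close>

definition yama_move :: "'a pair_pre_digraph \<Rightarrow> ('a \<Rightarrow> nat) \<Rightarrow> 'a \<Rightarrow> nat \<Rightarrow> 'a \<Rightarrow> nat" where
  "yama_move G p v k =
     (\<lambda>u. (if u = v then p u - k else p u) + (if v \<rightarrow>\<^bsub>with_proj G\<^esub> u then 1 else 0))"

definition yama_opts :: "'a pair_pre_digraph \<Rightarrow> ('a \<Rightarrow> nat) \<Rightarrow> ('a \<Rightarrow> nat) set" where
  "yama_opts G p =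
     {yama_move G p v k | v k. v \<in> pverts G \<and> out_degree (with_proj G) v + 1 \<le> k \<and> k \<le> p v}"

lemma (in pair_fin_digraph) yama_opts_decrease:
  assumes "q \<in> yama_opts G p"
  shows "sum q (pverts G) < sum p (pverts G)"
proof -
  obtain v k where v: "v \<in> pverts G" and k: "out_degree (with_proj G) v + 1 \<le> k" "k \<le> p v"
    and q: "q = yama_move G p v k"
    using assms by (auto simp: yama_opts_def)
  let ?N = "{u \<in> pverts G. (v, u) \<in> parcs G}"
  have "out_arcs (with_proj G) v = Pair v ` ?N"
    by (auto simp: out_arcs_def dest: in_arcsD2)
  then have deg: "out_degree (with_proj G) v = card ?N"
    by (simp add: out_degree_def card_image inj_on_def)
  have "sum q (pverts G) = (\<Sum>u\<in>pverts G. if u = v then p u - k else p u) + card ?N"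
    using pair_finite_verts by (simp add: q yama_move_def sum.distrib flip: sum.inter_filter)
  also have "(\<Sum>u\<in>pverts G. if u = v then p u - k else p u) = p v - k + sum p (pverts G - {v})"
    using v pair_finite_verts by (subst sum.remove[of _ v]) auto
  finally have "sum q (pverts G) = p v - k + sum p (pverts G - {v}) + card ?N" .
  moreover have "sum p (pverts G) = p v + sum p (pverts G - {v})"
    using v pair_finite_verts by (simp add: sum.remove)
  ultimately show ?thesis
    using k deg by linarith
qed

lemma (in pair_fin_digraph) wf_yama_opts: "wf (options_rel (yama_opts G))"
  by (rule wf_subset[OF wf_measure[of "\<lambda>p. sum p (pverts G)"]])
    (auto simp: options_rel_def yama_opts_decrease)

lemma (in pair_fin_digraph) finite_yama_opts: "finite (yama_opts G p)"
proof (rule finite_subset)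
  show "yama_opts G p \<subseteq> (\<Union>v\<in>pverts G. yama_move G p v ` {..p v})"
    by (auto simp: yama_opts_def)
qed (use pair_finite_verts in auto)

end

theory Submission
  imports Defs
begin

text \<open>
  The values \<open>y\<^sub>1 XOR \<dots> XOR y\<^sub>m\<close> satisfy the mex recursion. A move on \<open>W1\<close> is a move of ordinary
  Nim, so it changes the nim-sum, and every smaller value can be reached this way. A move on
  \<open>V1\<close> adds one token to each of the \<open>m\<close> vertices of \<open>W1\<close>; as \<open>m\<close> is odd, it flips the
  parity of \<open>y\<^sub>1 + \<dots> + y\<^sub>m\<close>, which is the parity of the nim-sum.
\<close>

section \<open>The mex function and P-positions\<close>

lemma mex_eqI:
  assumes "n \<notin> X" and "\<And>k. k < n \<Longrightarrow> k \<in> X"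
  shows "mex X = n"
  unfolding mex_def using assms by (intro Least_equality) (auto simp: not_less[symmetric])

lemma mex_notin:
  assumes "finite X"
  shows "mex X \<notin> X"
proof -
  obtain n where "n \<notin> X"
    using ex_new_if_finite[OF infinite_UNIV_nat assms] by blast
  then show ?thesis
    unfolding mex_def by (rule LeastI)
qed

lemma less_mexD: "k < mex X \<Longrightarrow> k \<in> X"
  unfolding mex_def using not_less_Least by blast

text \<open>The two conditions say that \<open>f p\<close> is the mex of the \<open>f\<close>-values
  of the options of \<open>p\<close>. Well-founded induction shows that the mex recursion has only
  one solution.\<close>

lemma grundy_eqI:
  assumes wf: "wf (options_rel opts)"
    and ne: "\<And>p q. q \<in> opts p \<Longrightarrow> f q \<noteq> f p"
    and ex: "\<And>p k. k < f p \<Longrightarrow> \<exists>q\<in>opts p. f q = k"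
  shows "grundy opts p = f p"
  using wf
proof (induction p)
  case (less p)
  then have "grundy opts q = f q" if "q \<in> opts p" for q
    using that by (simp add: options_rel_def)
  then have "grundy opts ` opts p = f ` opts p"
    by simp
  moreover have "mex (f ` opts p) = f p"
    using ne[of _ p] ex[of _ p] by (intro mex_eqI) (force, blast)
  ultimately show ?case
    by (simp add: grundy_rec[OF wf, of p])
qed

lemma grundy_eq_0_iff:
  assumes wf: "wf (options_rel opts)" and fin: "finite (opts p)"
  shows "grundy opts p = 0 \<longleftrightarrow> (\<forall>q\<in>opts p. grundy opts q \<noteq> 0)"
proof
  assume "grundy opts p = 0"
  then show "\<forall>q\<in>opts p. grundy opts q \<noteq> 0"
    using mex_notin[of "grundy opts ` opts p"] fin by (force simp: grundy_rec[OF wf, of p])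
next
  assume "\<forall>q\<in>opts p. grundy opts q \<noteq> 0"
  then show "grundy opts p = 0"
    using less_mexD[of 0 "grundy opts ` opts p"] by (force simp: grundy_rec[OF wf, of p])
qed

lemma is_play_snoc:
  "ps \<noteq> [] \<Longrightarrow> is_play opts p (ps @ [q]) \<longleftrightarrow> is_play opts p ps \<and> q \<in> opts (last ps)"
  by (auto simp: is_play_def successively_append_iff)

lemma prev_follows_snoc:
  "prev_follows \<sigma> (ps @ [q]) \<longleftrightarrow>
     prev_follows \<sigma> ps \<and> (ps \<noteq> [] \<and> even (length ps) \<longrightarrow> q = \<sigma> ps)"
  by (auto simp: prev_follows_def nth_append less_Suc_eq)

text \<open>The previous player answers every move by returning to Grundy value 0. A terminal
  position has value 0, so only the opponent can get stuck.\<close>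

lemma P_position_if_grundy_eq_0:
  assumes wf: "wf (options_rel opts)" and fin: "\<And>p. finite (opts p)"
    and zero: "grundy opts p = 0"
  shows "P_position opts p"
proof -
  note zero_iff = grundy_eq_0_iff[OF wf fin]
  \<comment> \<open>The implication makes the choice satisfiable at value 0 too:
    \<open>prev_strategy\<close> demands legal moves even in plays that do not follow
    \<open>\<sigma>\<close>.\<close>
  define \<sigma> where "\<sigma> ps = (SOME q. q \<in> opts (last ps) \<and>
    (grundy opts (last ps) \<noteq> 0 \<longrightarrow> grundy opts q = 0))" for ps
  have \<sigma>: "\<sigma> ps \<in> opts (last ps) \<and> (grundy opts (last ps) \<noteq> 0 \<longrightarrow> grundy opts (\<sigma> ps) = 0)"
    if "opts (last ps) \<noteq> {}" for ps
    unfolding \<sigma>_def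
  proof (rule someI_ex)
    show "\<exists>q. q \<in> opts (last ps) \<and> (grundy opts (last ps) \<noteq> 0 \<longrightarrow> grundy opts q = 0)"
      using that zero_iff[of "last ps"] by (cases "grundy opts (last ps) = 0") auto
  qed
  have inv: "grundy opts (last ps) = 0 \<longleftrightarrow> odd (length ps)"
    if "is_play opts p ps" "prev_follows \<sigma> ps" for ps
    using that
  proof (induction ps rule: rev_induct)
    case Nil
    then show ?case by (simp add: is_play_def)
  next
    case (snoc q ps)
    show ?case
    proof (cases "ps = []")
      case True
      then show ?thesis using snoc.prems zero by (simp add: is_play_def)
    next
      case False
      then have ps: "is_play opts p ps" "prev_follows \<sigma> ps" "q \<in> opts (last ps)"
        and q: "even (length ps) \<Longrightarrow> q = \<sigma> ps"
        using snoc.prems by (auto simp: is_play_snoc prev_follows_snoc)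
      have IH: "grundy opts (last ps) = 0 \<longleftrightarrow> odd (length ps)"
        using snoc.IH ps by blast
      show ?thesis
      proof (cases "odd (length ps)")
        case True
        then show ?thesis using IH ps(3) zero_iff[of "last ps"] by auto
      next
        case False
        then show ?thesis using IH ps(3) \<sigma>[of ps] q by auto
      qed
    qed
  qed
  have "odd (length ps)" if "is_play opts p ps" "prev_follows \<sigma> ps" "opts (last ps) = {}" for ps
    using inv[OF that(1,2)] that(3) zero_iff[of "last ps"] by simp
  then show ?thesis
    unfolding P_position_def prev_strategy_def using \<sigma> by blast
qed

text \<open>The next player moves to value 0. Either the opponent is then stuck, or any answer of
  \<open>\<sigma>\<close> leads back to a nonzero value with the next player on turn.\<close>

lemma next_player_beats_strategy:
  assumes wf: "wf (options_rel opts)" and fin: "\<And>p. finite (opts p)"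
    and \<sigma>: "prev_strategy opts p \<sigma>"
    and play: "is_play opts p ps" "prev_follows \<sigma> ps" "odd (length ps)"
    and nz: "grundy opts (last ps) \<noteq> 0"
  shows "\<exists>qs. is_play opts p qs \<and> prev_follows \<sigma> qs \<and> opts (last qs) = {} \<and> even (length qs)"
  \<comment> \<open>Each induction step covers a move and the reply to it, hence the transitive
    closure.\<close>
  using wf_trancl[OF wf] play nz
proof (induction "last ps" arbitrary: ps)
  case less
  note zero_iff = grundy_eq_0_iff[OF wf fin]
  obtain q where q: "q \<in> opts (last ps)" "grundy opts q = 0"
    using less.prems(4) zero_iff[of "last ps"] by auto
  have "ps \<noteq> []" using less.prems by auto
  with less.prems q have psq: "is_play opts p (ps @ [q])" "prev_follows \<sigma> (ps @ [q])"
    "even (length (ps @ [q]))"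
    by (auto simp: is_play_snoc prev_follows_snoc)
  show ?case
  proof (cases "opts q = {}")
    case True
    with psq show ?thesis by (metis last_snoc)
  next
    case False
    define r where "r = \<sigma> (ps @ [q])"
    have r: "r \<in> opts q"
      using \<sigma> psq False unfolding prev_strategy_def r_def by (metis last_snoc)
    define rs where "rs = (ps @ [q]) @ [r]"
    have "is_play opts p rs" "prev_follows \<sigma> rs" "odd (length rs)" "last rs = r"
      using psq r unfolding rs_def
      by (simp_all add: is_play_snoc prev_follows_snoc r_def del: append_assoc)
    moreover have "(r, last ps) \<in> (options_rel opts)\<^sup>+"
      using r q(1) by (auto simp: options_rel_def intro: trancl.intros)
    moreover have "grundy opts r \<noteq> 0"
      using zero_iff[of q] q(2) r by auto
    ultimately show ?thesis
      using less.hyps[of rs] by simp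
  qed
qed

lemma P_position_iff_grundy_eq_0:
  assumes wf: "wf (options_rel opts)" and fin: "\<And>p. finite (opts p)"
  shows "P_position opts p \<longleftrightarrow> grundy opts p = 0"
proof
  assume "P_position opts p"
  then obtain \<sigma> where \<sigma>: "prev_strategy opts p \<sigma>"
    and win: "\<And>ps. is_play opts p ps \<Longrightarrow> prev_follows \<sigma> ps \<Longrightarrow> opts (last ps) = {} \<Longrightarrow> odd (length ps)"
    unfolding P_position_def by blast
  have "is_play opts p [p]" "prev_follows \<sigma> [p]"
    by (simp_all add: is_play_def prev_follows_def)
  then show "grundy opts p = 0"
    using next_player_beats_strategy[OF wf fin \<sigma>, of "[p]"] win by fastforce
qed (rule P_position_if_grundy_eq_0[OF wf fin])

section \<open>Nim-sums\<close>

text \<open>The lowest binary digit of an XOR is the sum of the lowest digits modulo 2.\<close>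

lemma even_nim_sum_iff: "even (nim_sum f A) \<longleftrightarrow> even (sum f A)"
  by (induction A rule: infinite_finite_induct) (auto simp: even_xor_iff)

lemma bit_nim_sumD: "bit (nim_sum f A) k \<Longrightarrow> \<exists>a\<in>A. bit (f a) k"
  by (induction A rule: infinite_finite_induct) (auto simp: bit_xor_iff)

lemma xor_self_left: "a XOR (a XOR b) = b" for a b :: nat
  by (simp flip: xor.assoc)

lemma xor_eq_0_iff: "a XOR b = 0 \<longleftrightarrow> a = b" for a b :: nat
  by (metis xor_self_left xor.right_neutral xor_self_eq)

lemma nim_sum_fun_upd:
  assumes "finite A" "a \<in> A"
  shows "nim_sum (f(a := y)) A = nim_sum f A XOR f a XOR y"
proof -
  have "nim_sum (f(a := y)) (A - {a}) = nim_sum f (A - {a})"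
    by (rule nim_sum.cong) auto
  then show ?thesis
    using assms by (simp add: nim_sum.remove[of A a] ac_simps xor_self_left)
qed

text \<open>Bit \<open>k\<close> is the leading bit of \<open>d\<close>. XOR with \<open>d\<close>
  clears this bit in \<open>x\<close> and keeps all higher ones, so the quotient by
  \<open>2 ^ k\<close> drops, whatever happens below.\<close>

lemma xor_less_if_top_bit:
  fixes x d :: nat
  assumes "bit x k" "2 ^ k \<le> d" "d < 2 ^ Suc k"
  shows "x XOR d < x"
proof -
  have "drop_bit k d = 1"
    using assms(2,3) by (simp add: drop_bit_eq_div div_nat_eqI)
  moreover have "odd (drop_bit k x)"
    using assms(1) by (simp add: bit_iff_odd_drop_bit)
  ultimately have "drop_bit k (x XOR d) < drop_bit k x"
    by (auto simp: drop_bit_xor xor_Suc_0_eq elim: oddE)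
  then show ?thesis
    unfolding drop_bit_eq_div by (meson div_le_mono not_less)
qed

text \<open>This is Bouton's move in Nim: some heap contains the leading bit of the difference
  \<open>d\<close> between the nim-sum and the target \<open>k\<close>, and XOR with
  \<open>d\<close> shrinks that heap.\<close>

lemma ex_xor_less_of_less_nim_sum:
  assumes "k < nim_sum f A"
  shows "\<exists>a\<in>A. f a XOR nim_sum f A XOR k < f a"
proof -
  define d where "d = nim_sum f A XOR k"
  have "d > 0"
    using assms xor_eq_0_iff[of "nim_sum f A" k] by (auto simp: d_def)
  then obtain i where i: "2 ^ i \<le> d" "d < 2 ^ Suc i"
    using ex_power_ivl1[of 2 d] by auto
  \<comment> \<open>Otherwise XOR with \<open>d\<close> would lower \<open>k\<close>, but it turns
    \<open>k\<close> into the larger nim-sum.\<close>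
  have "\<not> bit k i"
  proof
    assume "bit k i"
    then have "k XOR d < k"
      using i by (rule xor_less_if_top_bit)
    then show False
      using assms by (simp add: d_def ac_simps xor_self_left)
  qed
  moreover have "d div 2 ^ i = 1"
    using i by (intro div_nat_eqI) auto
  then have "bit d i"
    by (simp add: bit_iff_odd)
  ultimately have "bit (nim_sum f A) i"
    by (auto simp: d_def bit_xor_iff)
  then obtain a where "a \<in> A" "bit (f a) i"
    using bit_nim_sumD by blast
  then show ?thesis
    using xor_less_if_top_bit[OF _ i] by (auto simp: d_def)
qed

section \<open>Moves in Digraph Yama Nim\<close>

lemma (in pair_fin_digraph) yama_move_sink:
  assumes "out_degree (with_proj G) v = 0"
  shows "yama_move G p v k = p(v := p v - k)"
proof -
  \<comment> \<open>Out-degree is a cardinality, and infinite sets have cardinality 0 by convention;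
    finiteness is what makes degree 0 mean that no arc leaves \<open>v\<close>.\<close>
  have "finite (out_arcs (with_proj G) v)"
    by (rule finite_subset[OF _ pair_finite_arcs]) auto
  then have "out_arcs (with_proj G) v = {}"
    using assms by (simp add: out_degree_def)
  then have "(v, u) \<notin> parcs G" for u
    by (auto simp: out_arcs_def)
  then show ?thesis
    by (auto simp: yama_move_def)
qed

text \<open>Tokens are removed outside \<open>W\<close> only, so the sum over \<open>W\<close> grows
  by the odd number \<open>card W\<close>, and the parity of the nim-sum changes with it.\<close>

lemma nim_sum_yama_move_dominating_neq:
  assumes "v \<notin> W" "\<forall>w\<in>W. (v, w) \<in> parcs G" "odd (card W)"
  shows "nim_sum (yama_move G p v k) W \<noteq> nim_sum p W"
proof -
  have "sum (yama_move G p v k) W = (\<Sum>w\<in>W. p w + 1)"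
    using assms(1,2) by (intro sum.cong) (auto simp: yama_move_def)
  also have "\<dots> = sum p W + card W"
    by (simp only: sum.distrib card_eq_sum)
  finally have "even (sum (yama_move G p v k) W) \<noteq> even (sum p W)"
    using assms(3) by simp
  then show ?thesis
    by (metis even_nim_sum_iff)
qed

theorem theorem8:
  fixes G4 :: "'a pair_pre_digraph" and V1 W1 :: "'a set" and p :: "'a \<Rightarrow> nat"
  assumes "pair_fin_digraph G4"
    and "pverts G4 = V1 \<union> W1" and "V1 \<inter> W1 = {}"
    and "\<forall>v\<in>V1. \<forall>w\<in>W1. (v, w) \<in> parcs G4"
    and "\<forall>w\<in>W1. out_degree (with_proj G4) w = 0"
    and "odd (card W1)"
  shows "grundy (yama_opts G4) p = nim_sum p W1 \<and>
         (P_position (yama_opts G4) p \<longleftrightarrow> nim_sum p W1 = 0)"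
proof -
  interpret pair_fin_digraph G4 by fact
  \<comment> \<open>An infinite set would have cardinality 0, which is even.\<close>
  have fin: "finite W1"
    using assms(6) card.infinite by fastforce
  have sink: "yama_move G4 p w k = p(w := p w - k)" if "w \<in> W1" for p w k
    using that assms(5) by (intro yama_move_sink) auto
  have "grundy (yama_opts G4) p = nim_sum p W1"
  proof (rule grundy_eqI[where f = "\<lambda>p. nim_sum p W1", OF wf_yama_opts])
    fix p q assume "q \<in> yama_opts G4 p"
    then obtain v k where "v \<in> pverts G4" and k: "out_degree (with_proj G4) v + 1 \<le> k" "k \<le> p v"
      and q: "q = yama_move G4 p v k"
      by (auto simp: yama_opts_def)
    then have v: "v \<in> V1 \<union> W1"
      using assms(2) by simp
    show "nim_sum q W1 \<noteq> nim_sum p W1"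
    proof (cases "v \<in> W1")
      case True
      then have "nim_sum q W1 = nim_sum p W1 XOR (p v XOR (p v - k))"
        unfolding q sink[OF True] nim_sum_fun_upd[OF fin True] by (simp only: xor.assoc)
      \<comment> \<open>Here \<open>1 \<le> k \<le> p v\<close>, so the truncated subtraction really
        changes the heap.\<close>
      moreover have "p v XOR (p v - k) \<noteq> 0"
        using k by (subst xor_eq_0_iff) linarith
      ultimately show ?thesis
        by (metis xor_self_left xor_self_eq)
    next
      case False
      then show ?thesis
        using v assms(4,6) unfolding q by (intro nim_sum_yama_move_dominating_neq) auto
    qed
  next
    fix p k assume "k < nim_sum p W1"
    then obtain w where w: "w \<in> W1" and less: "p w XOR nim_sum p W1 XOR k < p w"
      using ex_xor_less_of_less_nim_sum by blast
    \<comment> \<open>This heap size cancels the old contribution of \<open>w\<close> and brings the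
      nim-sum to \<open>k\<close>.\<close>
    define y where "y = p w XOR nim_sum p W1 XOR k"
    have "y < p w"
      using less by (simp add: y_def)
    then have "p(w := y) = yama_move G4 p w (p w - y)"
      using w by (simp add: sink)
    \<comment> \<open>At a sink the least legal removal is one token, so every smaller heap size can
      be reached.\<close>
    then have "p(w := y) \<in> yama_opts G4 p"
      using \<open>y < p w\<close> w assms(2,5) by (force simp: yama_opts_def)
    moreover have "nim_sum (p(w := y)) W1 = k"
    proof -
      have "nim_sum (p(w := y)) W1 = nim_sum p W1 XOR p w XOR y"
        using fin w by (rule nim_sum_fun_upd)
      also have "\<dots> = (nim_sum p W1 XOR nim_sum p W1) XOR (p w XOR p w) XOR k"
        by (simp only: y_def ac_simps)
      finally show ?thesis by simp
    qed
    ultimately show "\<exists>q\<in>yama_opts G4 p. nim_sum q W1 = k"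
      by blast
  qed
  then show ?thesis
    using P_position_iff_grundy_eq_0[OF wf_yama_opts finite_yama_opts] by simp
qed

end
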